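(* Let $\mathbb{S}:=\mathbb{J}$ when $M^H=\pm M$. Let $A\in\mathbb{S}$. Then for $\lambda\in\mathbb{R}$ there exists $\Delta A\in\mathbb{S}$ such that $\lambda\in\Lambda(A+\Delta A)$ and $\eta^{\mathbb{S}}(\lambda,A)=\|\Delta A\|_2=\eta(\lambda,A)$. Consequently, $$\Lambda^{\mathbb{S}}_\epsilon(A)\cap\mathbb{R}=\Lambda_\epsilon(A)\cap\mathbb{R}.$$ Next, consider $\mathbb{S}:=\mathbb{L}$ when $M^H=\pm M$. Let $A\in\mathbb{S}$. Then for $\lambda\in i\mathbb{R}$ there exists $\Delta A\in\mathbb{S}$ such that $\lambda\in\Lambda(A+\Delta A)$ and $\eta^{\mathbb{S}}(\lambda,A)=\|\Delta A\|_2=\eta(\lambda,A)$. Consequently, $$\Lambda^{\mathbb{S}}_\epsilon(A)\cap i\mathbb{R}=\Lambda_\epsilon(A)\cap i\mathbb{R}.$$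
   Context: Here $\mathbb{K}=\mathbb{C}$. $M\in\mathbb{C}^{n\times n}$ is unitary with $M^H=M$ or $M^H=-M$, defining the sesquilinear form $\langle x,y\rangle_M=y^HMx$ on $\mathbb{C}^n$ with adjoint $A^\star=M^{-1}A^HM$; $\mathbb{J}=\{A\in\mathbb{C}^{n\times n}:A^\star=A\}$, $\mathbb{L}=\{A\in\mathbb{C}^{n\times n}:A^\star=-A\}$. $\Lambda(A)$ denotes the spectrum of $A$. For $\lambda\in\mathbb{C}$, $x\in\mathbb{C}^n$, let $\eta^{\mathbb{S}}(A,x,\lambda):=\inf\{\|\Delta A\|_2:\Delta A\in\mathbb{S},\ (A+\Delta A)x=\lambda x\}$ ($=\infty$ if no such $\Delta A$ exists), and $\eta^{\mathbb{S}}(\lambda,A):=\inf\{\eta^{\mathbb{S}}(A,x,\lambda):x\in\mathbb{C}^n,\ \|x\|_2=1\}$. $\eta(\lambda,A)$ denotes $\eta^{\mathbb{S}}(\lambda,A)$ for $\mathbb{S}=\mathbb{C}^{n\times n}$. For $\epsilon>0$, the structured pseudospectrum is $\Lambda^{\mathbb{S}}_\epsilon(A):=\bigcup_{\|\Delta A\|_2\le\epsilon}\{\Lambda(A+\Delta A):\Delta A\in\mathbb{S}\}=\{\lambda\in\mathbb{C}:\eta^{\mathbb{S}}(\lambda,A)\le\epsilon\}$, and $\Lambda_\epsilon(A)$ (unstructured pseudospectrum) denotes it for $\mathbb{S}=\mathbb{C}^{n\times n}$. *)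

theory Defs
  imports "HOL-Analysis.Analysis"
begin

definition conj_transpose :: "complex^'n^'m \<Rightarrow> complex^'m^'n"
  where "conj_transpose A = (\<chi> i j. cnj (A $ j $ i))"

definition unitary_matrix :: "complex^'n^'n \<Rightarrow> bool"
  where "unitary_matrix M \<longleftrightarrow>
    conj_transpose M ** M = mat 1 \<and> M ** conj_transpose M = mat 1"

text \<open>Adjoint with respect to the sesquilinear form \<open>\<langle>x, y\<rangle> = y\<^sup>H M x\<close>.\<close>

definition form_adjoint :: "complex^'n^'n \<Rightarrow> complex^'n^'n \<Rightarrow> complex^'n^'n"
  where "form_adjoint M A = matrix_inv M ** conj_transpose A ** M"

definition jordan_algebra :: "complex^'n^'n \<Rightarrow> (complex^'n^'n) set"
  where "jordan_algebra M = {A. form_adjoint M A = A}"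

definition lie_algebra :: "complex^'n^'n \<Rightarrow> (complex^'n^'n) set"
  where "lie_algebra M = {A. form_adjoint M A = - A}"

definition spectrum :: "complex^'n^'n \<Rightarrow> complex set"
  where "spectrum A = {\<mu>. \<exists>x. x \<noteq> 0 \<and> A *v x = \<mu> *s x}"

text \<open>The library norm on \<^typ>\<open>complex^'n\<close> is the Euclidean one, so the induced operator norm
  is the spectral norm. The library norm on \<^typ>\<open>complex^'n^'n\<close> itself would be the
  Frobenius norm.\<close>

definition spectral_norm :: "complex^'n^'n \<Rightarrow> real"
  where "spectral_norm A = onorm (\<lambda>x. A *v x)"

text \<open>Backward errors are extended reals, so that the infimum over the empty set is \<open>\<infinity>\<close>.\<close>

definition eigenpair_error ::
    "(complex^'n^'n) set \<Rightarrow> complex^'n^'n \<Rightarrow> complex^'n \<Rightarrow> complex \<Rightarrow> ereal"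
  where "eigenpair_error S A x \<mu> =
    (INF \<Delta> \<in> {\<Delta> \<in> S. (A + \<Delta>) *v x = \<mu> *s x}. ereal (spectral_norm \<Delta>))"

definition eigenvalue_error ::
    "(complex^'n^'n) set \<Rightarrow> complex \<Rightarrow> complex^'n^'n \<Rightarrow> ereal"
  where "eigenvalue_error S \<mu> A = (INF x \<in> {x. norm x = 1}. eigenpair_error S A x \<mu>)"

definition pseudospectrum ::
    "(complex^'n^'n) set \<Rightarrow> real \<Rightarrow> complex^'n^'n \<Rightarrow> complex set"
  where "pseudospectrum S \<epsilon> A =
    (\<Union>\<Delta> \<in> {\<Delta> \<in> S. spectral_norm \<Delta> \<le> \<epsilon>}. spectrum (A + \<Delta>))"

definition imaginary_axis :: "complex set"
  where "imaginary_axis = range (\<lambda>t::real. \<i> * complex_of_real t)"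

end

theory Submission
  imports Defs
begin

text \<open>
  Multiplying by \<open>N = c M\<close>, with \<open>c \<in> {1, \<i>}\<close> chosen according to the symmetry of \<open>M\<close>, turns
  membership in the Jordan or Lie algebra into Hermiticity of \<open>N A\<close>; the condition on \<open>\<mu>\<close> says that
  the scalar matrix \<open>\<mu> I\<close> belongs to the same algebra. So \<open>B = N (A - \<mu> I)\<close> is Hermitian, and it has
  a real eigenvalue \<open>s\<close> of minimal modulus, with \<open>\<bar>s\<bar>\<close> the smallest singular value of \<open>A - \<mu> I\<close>.
  The structured perturbation \<open>- s N\<^sup>H\<close> has norm \<open>\<bar>s\<bar>\<close>, which is also a lower bound for
  unstructured ones.
\<close>

section \<open>Eigenvalues of minimal modulus for self-adjoint maps\<close>

text \<open>A minimiser \<open>x\<close> of \<open>norm (f x)\<close> on the unit sphere, with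
  minimum \<open>r\<close>, satisfies \<open>f (f x) = r^2 x\<close> by stationarity. Hence
  \<open>r\<close> or \<open>-r\<close> is an eigenvalue. Working over a real space makes the
  eigenvalue real from the start.\<close>

lemma selfadjoint_min_eigenvalue:
  fixes f :: "'a::euclidean_space \<Rightarrow> 'a"
  assumes lin: "linear f" and sa: "\<And>x y. f x \<bullet> y = x \<bullet> f y"
  obtains x s where "x \<noteq> 0" "f x = s *\<^sub>R x" "\<And>y. \<bar>s\<bar> * norm y \<le> norm (f y)"
proof -
  have "continuous_on (sphere 0 1) (\<lambda>x. norm (f x))"
    using lin by (simp add: continuous_on_norm linear_continuous_on linear_conv_bounded_linear)
  then obtain x where x: "norm x = 1" and min: "\<And>y. norm y = 1 \<Longrightarrow> norm (f x) \<le> norm (f y)"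
    using continuous_attains_inf[of "sphere (0::'a) 1" "\<lambda>x. norm (f x)"] by auto
  define r where "r = norm (f x)"
  have bound: "r * norm y \<le> norm (f y)" for y
  proof (cases "y = 0")
    case False
    have "r \<le> norm (f (inverse (norm y) *\<^sub>R y))"
      unfolding r_def using False by (intro min) simp
    then show ?thesis
      using False by (simp add: linear_scale[OF lin] field_simps)
  qed (simp add: linear_0[OF lin])
  \<comment> \<open>Up to a factor 2, \<open>g\<close> is the gradient at \<open>x\<close> of the
    quadratic form \<open>norm (f y)^2 - r^2 * norm y^2\<close>, and \<open>K\<close> is the value
    of that form at \<open>g\<close>. The form is nonnegative and vanishes at \<open>x\<close>, so
    the gradient must be zero.\<close>
  define g where "g = f (f x) - r\<^sup>2 *\<^sub>R x"
  define K where "K = (norm (f g))\<^sup>2 - r\<^sup>2 * (norm g)\<^sup>2"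
  have "0 \<le> K"
    using power_mono[OF bound[of g], of 2] by (simp add: K_def r_def power_mult_distrib)
  \<comment> \<open>First variation at the minimiser \<open>x\<close> of \<open>\<parallel>f y\<parallel>\<^sup>2 - r\<^sup>2 \<parallel>y\<parallel>\<^sup>2\<close>, in the direction \<open>g\<close>.\<close>
  have var: "0 \<le> 2 * t * (norm g)\<^sup>2 + t\<^sup>2 * K" for t
  proof -
    have "(r * norm (x + t *\<^sub>R g))\<^sup>2 \<le> (norm (f (x + t *\<^sub>R g)))\<^sup>2"
      using bound by (intro power_mono) (auto simp: r_def)
    moreover have "(norm (x + t *\<^sub>R g))\<^sup>2 = 1 + 2 * t * (x \<bullet> g) + t\<^sup>2 * (norm g)\<^sup>2"
      unfolding power2_norm_eq_inner using x
      by (simp add: norm_eq_1 inner_simps inner_commute power2_eq_square algebra_simps)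
    moreover have "(norm (f (x + t *\<^sub>R g)))\<^sup>2
        = r\<^sup>2 + 2 * t * (f (f x) \<bullet> g) + t\<^sup>2 * (norm (f g))\<^sup>2"
      unfolding r_def power2_norm_eq_inner
      by (simp add: linear_add[OF lin] linear_scale[OF lin] inner_simps sa[of "f x"]
          inner_commute[of "f g" "f x"] power2_eq_square algebra_simps)
    ultimately have "r\<^sup>2 * (1 + 2 * t * (x \<bullet> g) + t\<^sup>2 * (norm g)\<^sup>2)
        \<le> r\<^sup>2 + 2 * t * (f (f x) \<bullet> g) + t\<^sup>2 * (norm (f g))\<^sup>2"
      by (simp only: power_mult_distrib)
    moreover have "(norm g)\<^sup>2 = f (f x) \<bullet> g - r\<^sup>2 * (x \<bullet> g)"
      unfolding power2_norm_eq_inner by (subst (1) g_def) (simp add: inner_simps)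
    then have lin_term: "2 * t * (norm g)\<^sup>2 = 2 * t * (f (f x) \<bullet> g - r\<^sup>2 * (x \<bullet> g))"
      by (simp only:)
    ultimately show ?thesis
      unfolding K_def lin_term by (simp add: algebra_simps)
  qed
  have "g = 0"
  proof (rule ccontr)
    assume "g \<noteq> 0"
    then have G: "(norm g)\<^sup>2 > 0" by simp
    \<comment> \<open>A short step against the gradient, where the linear term beats the quadratic
      one. The summand 1 keeps the denominator positive when \<open>K = 0\<close>.\<close>
    define t where "t = - (norm g)\<^sup>2 / (K + 1)"
    have "t * (K + 1) = - (norm g)\<^sup>2" "t < 0"
      using G \<open>0 \<le> K\<close> by (auto simp: t_def divide_neg_pos)
    then have "2 * t * (norm g)\<^sup>2 + t\<^sup>2 * K = - (t\<^sup>2 * (K + 2))"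
      by (simp add: power2_eq_square) algebra
    also have "\<dots> < 0"
      using \<open>t < 0\<close> \<open>0 \<le> K\<close> by simp
    finally show False
      using var[of t] by simp
  qed
  \<comment> \<open>Since \<open>(f - r)(f + r) x = 0\<close>, the vector \<open>f x + r x\<close>
    is either zero, so that \<open>x\<close> is an eigenvector for \<open>-r\<close>, or an
    eigenvector for \<open>r\<close>.\<close>
  then have fac: "f (f x + r *\<^sub>R x) = r *\<^sub>R (f x + r *\<^sub>R x)"
    by (simp add: g_def linear_add[OF lin] linear_scale[OF lin] power2_eq_square scaleR_add_right)
  have abs_r: "\<bar>r\<bar> = r" by (simp add: r_def)
  show thesis
  proof (cases "f x + r *\<^sub>R x = 0")
    case True
    then have "f x = (- r) *\<^sub>R x" by (simp add: eq_neg_iff_add_eq_0)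
    moreover have "x \<noteq> 0" using x by auto
    ultimately show thesis using bound abs_r by (intro that[of x "- r"]) auto
  next
    case False
    then show thesis using fac bound abs_r by (intro that[of _ r]) auto
  qed
qed

section \<open>Conjugate transposes, scalar matrices and unitary matrices\<close>

text \<open>On complex vectors \<open>\<bullet>\<close> is the real part of the Hermitian inner
  product. Hermitian matrices therefore act as self-adjoint maps of the underlying real space, to
  which \<open>selfadjoint_min_eigenvalue\<close> applies.\<close>

lemma inner_conj_transpose: "(A *v x) \<bullet> y = x \<bullet> (conj_transpose A *v y)"
proof -
  have "(A *v x) \<bullet> y = (\<Sum>i\<in>UNIV. \<Sum>j\<in>UNIV. (A $ i $ j * x $ j) \<bullet> y $ i)"
    by (simp add: inner_vec_def matrix_vector_mult_def inner_sum_left)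
  also have "\<dots> = (\<Sum>j\<in>UNIV. \<Sum>i\<in>UNIV. (A $ i $ j * x $ j) \<bullet> y $ i)"
    by (rule sum.swap)
  also have "\<dots> = (\<Sum>j\<in>UNIV. \<Sum>i\<in>UNIV. x $ j \<bullet> (cnj (A $ i $ j) * y $ i))"
    by (intro sum.cong refl) (simp add: inner_complex_def algebra_simps)
  also have "\<dots> = x \<bullet> (conj_transpose A *v y)"
    by (simp add: inner_vec_def matrix_vector_mult_def conj_transpose_def inner_sum_right)
  finally show ?thesis .
qed

lemma conj_transpose_conj_transpose [simp]: "conj_transpose (conj_transpose A) = A"
  by (simp add: conj_transpose_def vec_eq_iff)

lemma conj_transpose_mult:
  "conj_transpose (A ** B) = conj_transpose B ** conj_transpose A"
  by (simp add: conj_transpose_def matrix_matrix_mult_def vec_eq_iff mult.commute)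

lemma conj_transpose_mat: "conj_transpose (mat c) = mat (cnj c)"
  by (auto simp: conj_transpose_def mat_def vec_eq_iff)

lemma matrix_diff_ldistrib: "A ** (B - C) = A ** B - A ** C"
  for A B C :: "complex^'n^'n"
  by (simp add: matrix_matrix_mult_def vec_eq_iff sum_subtractf right_diff_distrib)

lemma conj_transpose_diff: "conj_transpose (A - B) = conj_transpose A - conj_transpose B"
  by (simp add: conj_transpose_def vec_eq_iff)

lemma mat_mult_component: "(mat c ** A) $ i $ j = c * A $ i $ j"
  for c :: complex
  by (simp add: mat_def matrix_matrix_mult_def if_distrib[where f = "\<lambda>z. z * _"] cong: if_cong)

lemma mult_mat_component: "(A ** mat c) $ i $ j = c * A $ i $ j"
  for c :: complex
  by (simp add: mat_def matrix_matrix_mult_def if_distrib[where f = "\<lambda>z. _ * z"] mult.commute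
      cong: if_cong)

lemma mat_mult_commute: "A ** mat c = mat c ** A"
  for c :: complex
  by (simp add: vec_eq_iff mat_mult_component mult_mat_component)

lemma mat_mult_mat: "mat c ** mat d = mat (c * d)"
  for c d :: complex
  by (simp add: vec_eq_iff mat_mult_component) (simp add: mat_def)

lemma mat_mult_vector: "mat c *v x = c *s x"
  for c :: complex
  by (simp add: vec_eq_iff mat_def matrix_vector_mult_def if_distrib[where f = "\<lambda>z. z * _"]
      cong: if_cong)

lemma of_real_vector_smult: "complex_of_real s *s x = s *\<^sub>R x"
  by (simp add: vec_eq_iff scaleR_conv_of_real[where 'a = complex])

lemma unitary_matrix_conj_transpose: "unitary_matrix N \<Longrightarrow> unitary_matrix (conj_transpose N)"
  by (simp add: unitary_matrix_def)

lemma unitary_matrix_mat_mult: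
  assumes "unitary_matrix N" "cmod c = 1"
  shows "unitary_matrix (mat c ** N)"
proof -
  have c: "cnj c * c = 1" "c * cnj c = 1"
    using assms(2) by (simp_all add: complex_norm_square[symmetric] mult.commute)
  have "conj_transpose N ** mat (cnj c) ** (mat c ** N) = conj_transpose N ** mat (cnj c * c) ** N"
    by (simp add: mat_mult_mat[symmetric] matrix_mul_assoc)
  moreover have "mat c ** N ** (conj_transpose N ** mat (cnj c))
      = mat c ** (N ** conj_transpose N) ** mat (cnj c)"
    by (simp add: matrix_mul_assoc)
  ultimately show ?thesis
    using assms(1) c
    by (simp add: unitary_matrix_def conj_transpose_mult conj_transpose_mat mat_mult_mat)
qed

lemma norm_unitary_matrix:
  assumes "unitary_matrix N"
  shows "norm (N *v x) = norm x"
proof -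
  have "(N *v x) \<bullet> (N *v x) = x \<bullet> x"
    unfolding inner_conj_transpose matrix_vector_mul_assoc
    using assms by (simp add: unitary_matrix_def)
  then show ?thesis
    by (simp only: norm_eq_sqrt_inner)
qed

lemma matrix_inv_unitary:
  assumes "unitary_matrix N"
  shows "matrix_inv N = conj_transpose N"
proof -
  have "\<exists>N'. N ** N' = mat 1 \<and> N' ** N = mat 1"
    using assms by (auto simp: unitary_matrix_def)
  then have "matrix_inv N ** N = mat 1"
    unfolding matrix_inv_def by (rule someI_ex[THEN conjunct2])
  then have "(matrix_inv N ** N) ** conj_transpose N = conj_transpose N"
    by simp
  then show ?thesis
    using assms by (simp add: matrix_mul_assoc[symmetric] unitary_matrix_def)
qed

lemma unitary_mult_left_cancel:
  assumes "unitary_matrix N"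
  shows "N ** X = N ** Y \<longleftrightarrow> X = Y"
proof
  assume "N ** X = N ** Y"
  then have "conj_transpose N ** (N ** X) = conj_transpose N ** (N ** Y)" by simp
  then show "X = Y" using assms by (simp add: matrix_mul_assoc unitary_matrix_def)
qed simp

lemma form_adjoint_eq_iff:
  assumes "unitary_matrix M"
  shows "form_adjoint M A = X \<longleftrightarrow> conj_transpose A ** M = M ** X"
proof -
  have "M ** form_adjoint M A = conj_transpose A ** M"
    using assms by (simp add: form_adjoint_def matrix_inv_unitary matrix_mul_assoc unitary_matrix_def)
  then show ?thesis
    using unitary_mult_left_cancel[OF assms, of "form_adjoint M A" X] by auto
qed

lemma norm_le_spectral_norm: "norm (A *v x) \<le> spectral_norm A * norm x"
  unfolding spectral_norm_def by (rule onorm) simp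

section \<open>Optimal perturbations in the Hermitian case\<close>

lemma hermitian_optimal_perturbation:
  fixes N A :: "complex^'n^'n"
  assumes N: "unitary_matrix N"
    and A: "conj_transpose (N ** A) = N ** A"
    and \<mu>: "conj_transpose (N ** mat \<mu>) = N ** mat \<mu>"
  shows "\<exists>\<Delta>. conj_transpose (N ** \<Delta>) = N ** \<Delta> \<and> \<mu> \<in> spectrum (A + \<Delta>) \<and>
    (\<forall>\<Delta>'. \<mu> \<in> spectrum (A + \<Delta>') \<longrightarrow> spectral_norm \<Delta> \<le> spectral_norm \<Delta>')"
proof -
  define B where "B = N ** (A - mat \<mu>)"
  have B: "conj_transpose B = B"
    using A \<mu> by (simp add: B_def matrix_diff_ldistrib conj_transpose_diff)
  obtain x s where x: "x \<noteq> 0" and Bx: "B *v x = s *\<^sub>R x"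
    and s: "\<And>y. \<bar>s\<bar> * norm y \<le> norm (B *v y)"
    using selfadjoint_min_eigenvalue[of "(*v) B"] inner_conj_transpose[of B] B
    by (metis matrix_vector_mul_linear)
  have NB: "A *v y - \<mu> *s y = conj_transpose N *v (B *v y)" for y
    using N by (simp add: B_def matrix_vector_mul_assoc matrix_mul_assoc unitary_matrix_def
        matrix_vector_mult_diff_rdistrib mat_mult_vector)
  \<comment> \<open>With this choice \<open>N ** (A + \<Delta> - mat \<mu>)\<close> is
    \<open>B\<close> shifted by \<open>-s\<close>, which annihilates \<open>x\<close>; and
    \<open>N ** \<Delta>\<close> is Hermitian because \<open>s\<close> is real.\<close>
  define \<Delta> where "\<Delta> = conj_transpose N ** mat (complex_of_real (- s))"
  have \<Delta>y: "\<Delta> *v y = conj_transpose N *v (- (s *\<^sub>R y))" for y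
    unfolding \<Delta>_def
    by (simp only: matrix_vector_mul_assoc[symmetric] mat_mult_vector of_real_vector_smult
        scaleR_minus_left)
  have "N ** \<Delta> = mat (complex_of_real (- s))"
    using N by (simp add: \<Delta>_def matrix_mul_assoc unitary_matrix_def)
  then have "conj_transpose (N ** \<Delta>) = N ** \<Delta>"
    by (simp add: conj_transpose_mat)
  moreover have "A *v x + \<Delta> *v x = \<mu> *s x"
    using NB[of x] by (simp add: \<Delta>y Bx vec.neg algebra_simps)
  then have "\<mu> \<in> spectrum (A + \<Delta>)"
    using x by (auto simp: spectrum_def matrix_vector_mult_add_rdistrib)
  moreover have "spectral_norm \<Delta> \<le> spectral_norm \<Delta>'" if spec: "\<mu> \<in> spectrum (A + \<Delta>')" for \<Delta>'
  proof -
    obtain y where y: "y \<noteq> 0" "A *v y + \<Delta>' *v y = \<mu> *s y"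
      using spec by (auto simp: spectrum_def matrix_vector_mult_add_rdistrib)
    have "spectral_norm \<Delta> \<le> \<bar>s\<bar>"
      unfolding spectral_norm_def
      using norm_unitary_matrix[OF unitary_matrix_conj_transpose[OF N]]
      by (intro onorm_le) (simp add: \<Delta>y)
    \<comment> \<open>Any competitor must cancel \<open>A - mat \<mu>\<close> on its eigenvector
      \<open>y\<close>, so it maps \<open>y\<close> to a vector of the same length as
      \<open>B *v y\<close>, at least \<open>\<bar>s\<bar> * norm y\<close>.\<close>
    moreover have "\<Delta>' *v y = - (conj_transpose N *v (B *v y))"
      using y(2) NB[of y] by (simp add: eq_neg_iff_add_eq_0 algebra_simps)
    then have "norm (\<Delta>' *v y) = norm (B *v y)"
      using norm_unitary_matrix[OF unitary_matrix_conj_transpose[OF N]] by simp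
    then have "\<bar>s\<bar> * norm y \<le> spectral_norm \<Delta>' * norm y"
      using s[of y] norm_le_spectral_norm[of \<Delta>' y] by linarith
    then have "\<bar>s\<bar> \<le> spectral_norm \<Delta>'"
      using y(1) by simp
    ultimately show ?thesis by linarith
  qed
  ultimately show ?thesis by blast
qed

section \<open>From optimal perturbations to backward errors and pseudospectra\<close>

text \<open>Minimality is demanded among all matrices and not just within \<open>S\<close>, so one
  \<open>\<Delta>\<close> attains the infimum both for \<open>S\<close> and for
  \<open>UNIV\<close>.\<close>

lemma eigenvalue_error_eq:
  assumes "\<Delta> \<in> S" and "\<mu> \<in> spectrum (A + \<Delta>)"
    and min: "\<And>\<Delta>'. \<mu> \<in> spectrum (A + \<Delta>') \<Longrightarrow> spectral_norm \<Delta> \<le> spectral_norm \<Delta>'"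
  shows "eigenvalue_error S \<mu> A = ereal (spectral_norm \<Delta>)"
proof (rule antisym)
  obtain x where x: "x \<noteq> 0" "(A + \<Delta>) *v x = \<mu> *s x"
    using assms(2) by (auto simp: spectrum_def)
  \<comment> \<open>The eigenvector is normalised because the error is an infimum over unit
    vectors.\<close>
  define u where "u = complex_of_real (inverse (norm x)) *s x"
  have "norm u = 1"
    unfolding u_def of_real_vector_smult using x(1) by simp
  moreover have "(A + \<Delta>) *v u = \<mu> *s u"
    unfolding u_def vector_scalar_commute x(2) by (simp add: mult.commute)
  ultimately have "eigenvalue_error S \<mu> A \<le> eigenpair_error S A u \<mu>"
    and "eigenpair_error S A u \<mu> \<le> ereal (spectral_norm \<Delta>)"
    using assms(1) by (auto simp: eigenvalue_error_def eigenpair_error_def intro!: INF_lower)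
  then show "eigenvalue_error S \<mu> A \<le> ereal (spectral_norm \<Delta>)"
    by (rule order_trans)
  show "ereal (spectral_norm \<Delta>) \<le> eigenvalue_error S \<mu> A"
    unfolding eigenvalue_error_def eigenpair_error_def
  proof (intro INF_greatest)
    fix y \<Delta>' assume "y \<in> {y. norm y = 1}" "\<Delta>' \<in> {\<Delta> \<in> S. (A + \<Delta>) *v y = \<mu> *s y}"
    then have "\<mu> \<in> spectrum (A + \<Delta>')"
      unfolding spectrum_def by (auto intro!: exI[of _ y])
    then show "ereal (spectral_norm \<Delta>) \<le> ereal (spectral_norm \<Delta>')"
      using min by simp
  qed
qed

text \<open>A structured minimiser gives both errors the same value. For pseudospectra, it replaces
  an arbitrary perturbation without increasing the norm.\<close>

lemma structured_eq_unstructured: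
  assumes "\<And>\<mu>. \<mu> \<in> L \<Longrightarrow> \<exists>\<Delta>\<in>S. \<mu> \<in> spectrum (A + \<Delta>) \<and>
    (\<forall>\<Delta>'. \<mu> \<in> spectrum (A + \<Delta>') \<longrightarrow> spectral_norm \<Delta> \<le> spectral_norm \<Delta>')"
  shows "(\<forall>\<mu>\<in>L. \<exists>\<Delta>\<in>S. \<mu> \<in> spectrum (A + \<Delta>) \<and>
      eigenvalue_error S \<mu> A = ereal (spectral_norm \<Delta>) \<and>
      ereal (spectral_norm \<Delta>) = eigenvalue_error UNIV \<mu> A) \<and>
    (\<forall>\<epsilon>>0. pseudospectrum S \<epsilon> A \<inter> L = pseudospectrum UNIV \<epsilon> A \<inter> L)"
proof (intro conjI ballI allI impI)
  fix \<mu> assume "\<mu> \<in> L"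
  then obtain \<Delta> where \<Delta>: "\<Delta> \<in> S" "\<mu> \<in> spectrum (A + \<Delta>)"
    "\<And>\<Delta>'. \<mu> \<in> spectrum (A + \<Delta>') \<Longrightarrow> spectral_norm \<Delta> \<le> spectral_norm \<Delta>'"
    using assms by blast
  then show "\<exists>\<Delta>\<in>S. \<mu> \<in> spectrum (A + \<Delta>) \<and>
      eigenvalue_error S \<mu> A = ereal (spectral_norm \<Delta>) \<and>
      ereal (spectral_norm \<Delta>) = eigenvalue_error UNIV \<mu> A"
    using eigenvalue_error_eq[OF \<Delta>] eigenvalue_error_eq[OF UNIV_I \<Delta>(2,3)] by metis
next
  fix \<epsilon> :: real
  show "pseudospectrum S \<epsilon> A \<inter> L = pseudospectrum UNIV \<epsilon> A \<inter> L"
  proof (intro equalityI subsetI)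
    fix \<mu> assume "\<mu> \<in> pseudospectrum UNIV \<epsilon> A \<inter> L"
    then obtain \<Delta>' where "\<mu> \<in> L" "spectral_norm \<Delta>' \<le> \<epsilon>" "\<mu> \<in> spectrum (A + \<Delta>')"
      by (auto simp: pseudospectrum_def)
    moreover from this obtain \<Delta> where "\<Delta> \<in> S" "\<mu> \<in> spectrum (A + \<Delta>)" "spectral_norm \<Delta> \<le> spectral_norm \<Delta>'"
      using assms by blast
    ultimately show "\<mu> \<in> pseudospectrum S \<epsilon> A \<inter> L"
      unfolding pseudospectrum_def using order_trans by blast
  qed (auto simp: pseudospectrum_def)
qed

lemma hermitian_structured_eq_unstructured:
  assumes "unitary_matrix N" and S: "S = {X. conj_transpose (N ** X) = N ** X}"
    and "A \<in> S" and "\<And>\<mu>. \<mu> \<in> L \<Longrightarrow> mat \<mu> \<in> S"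
  shows "(\<forall>\<mu>\<in>L. \<exists>\<Delta>\<in>S. \<mu> \<in> spectrum (A + \<Delta>) \<and>
      eigenvalue_error S \<mu> A = ereal (spectral_norm \<Delta>) \<and>
      ereal (spectral_norm \<Delta>) = eigenvalue_error UNIV \<mu> A) \<and>
    (\<forall>\<epsilon>>0. pseudospectrum S \<epsilon> A \<inter> L = pseudospectrum UNIV \<epsilon> A \<inter> L)"
proof (rule structured_eq_unstructured)
  fix \<mu> assume "\<mu> \<in> L"
  then show "\<exists>\<Delta>\<in>S. \<mu> \<in> spectrum (A + \<Delta>) \<and>
    (\<forall>\<Delta>'. \<mu> \<in> spectrum (A + \<Delta>') \<longrightarrow> spectral_norm \<Delta> \<le> spectral_norm \<Delta>')"
    using hermitian_optimal_perturbation[of N A \<mu>] assms by auto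
qed

section \<open>Jordan and Lie algebras as Hermitian classes\<close>

text \<open>The sign \<open>p\<close> records the symmetry of \<open>M\<close>, and \<open>q\<close>
  selects the Jordan or Lie condition. Both sides of the Hermitian equation carry the nonzero factor
  \<open>cnj c * p\<close>; cancelling it leaves
  \<open>conj_transpose X ** M = M ** (mat q ** X)\<close>.\<close>

lemma form_adjoint_eq_iff_hermitian:
  assumes M: "unitary_matrix M" "conj_transpose M = mat p ** M" and c: "c \<noteq> 0" "c = cnj c * p * q"
  shows "form_adjoint M X = mat q ** X \<longleftrightarrow>
    conj_transpose (mat c ** M ** X) = mat c ** M ** X"
proof -
  have "conj_transpose (mat c ** M ** X) = conj_transpose X ** (mat p ** M ** mat (cnj c))"
    by (simp add: conj_transpose_mult conj_transpose_mat M(2))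
  also have "\<dots> = conj_transpose X ** (mat (cnj c * p) ** M)"
    by (simp add: mat_mult_commute[of "mat p ** M"] matrix_mul_assoc mat_mult_mat)
  also have "\<dots> = mat (cnj c * p) ** (conj_transpose X ** M)"
    by (simp add: matrix_mul_assoc mat_mult_commute[of "conj_transpose X"])
  finally have 1: "conj_transpose (mat c ** M ** X) = mat (cnj c * p) ** (conj_transpose X ** M)" .
  have "mat c ** M ** X = mat (cnj c * p) ** (mat q ** M ** X)"
    by (subst c(2)) (simp add: matrix_mul_assoc mat_mult_mat)
  also have "\<dots> = mat (cnj c * p) ** (M ** (mat q ** X))"
    by (simp add: matrix_mul_assoc mat_mult_commute[of M])
  finally have 2: "mat c ** M ** X = mat (cnj c * p) ** (M ** (mat q ** X))" .
  have "cnj c * p \<noteq> 0"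
    using c by auto
  then show ?thesis
    unfolding form_adjoint_eq_iff[OF M(1)]
    by (subst 1, subst 2) (simp add: vec_eq_iff mat_mult_component)
qed

text \<open>The two signs treat all four cases at once. The set \<open>L\<close> consists of the
  \<open>\<mu>\<close> with \<open>mat \<mu>\<close> in \<open>S\<close>: the real axis for
  \<open>q = 1\<close>, the imaginary axis for \<open>q = -1\<close>.\<close>

lemma form_structured_eq_unstructured:
  assumes M: "unitary_matrix M" "conj_transpose M = mat p ** M" and "p \<in> {1, -1}" "q \<in> {1, -1}"
    and S: "S = {X. form_adjoint M X = mat q ** X}" and L: "L = {\<mu>. cnj \<mu> = q * \<mu>}" and "A \<in> S"
  shows "(\<forall>\<mu>\<in>L. \<exists>\<Delta>\<in>S. \<mu> \<in> spectrum (A + \<Delta>) \<and>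
      eigenvalue_error S \<mu> A = ereal (spectral_norm \<Delta>) \<and>
      ereal (spectral_norm \<Delta>) = eigenvalue_error UNIV \<mu> A) \<and>
    (\<forall>\<epsilon>>0. pseudospectrum S \<epsilon> A \<inter> L = pseudospectrum UNIV \<epsilon> A \<inter> L)"
proof -
  \<comment> \<open>The requirement \<open>c = cnj c * p * q\<close> asks for a real
    \<open>c\<close> if \<open>p * q = 1\<close> and an imaginary one if
    \<open>p * q = -1\<close>.\<close>
  define c where "c = (if p = q then 1 else \<i>)"
  have c: "cmod c = 1" "c \<noteq> 0" "c = cnj c * p * q"
    using assms(3,4) by (auto simp: c_def)
  show ?thesis
  proof (rule hermitian_structured_eq_unstructured)
    show "unitary_matrix (mat c ** M)"
      using M(1) c(1) by (rule unitary_matrix_mat_mult)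
    show "S = {X. conj_transpose (mat c ** M ** X) = mat c ** M ** X}"
      unfolding S using form_adjoint_eq_iff_hermitian[OF M c(2,3)] by simp
    show "mat \<mu> \<in> S" if "\<mu> \<in> L" for \<mu>
      using that unfolding S L
      by (simp add: form_adjoint_eq_iff[OF M(1)] conj_transpose_mat mat_mult_mat mat_mult_commute[of M])
  qed fact
qed

lemma Reals_eq_cnj_fixed: "\<real> = {\<mu>. cnj \<mu> = 1 * \<mu>}"
  by (auto simp: Reals_cnj_iff)

lemma imaginary_axis_eq: "imaginary_axis = {\<mu>. cnj \<mu> = - 1 * \<mu>}"
proof (intro equalityI subsetI)
  fix \<mu> assume "\<mu> \<in> {\<mu>. cnj \<mu> = - 1 * \<mu>}"
  then have "\<mu> = \<i> * complex_of_real (Im \<mu>)"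
    by (simp add: complex_eq_iff)
  then show "\<mu> \<in> imaginary_axis"
    unfolding imaginary_axis_def by blast
qed (auto simp: imaginary_axis_def)

lemma mat_neg_one_mult: "mat (- 1 :: complex) ** A = - A"
  by (simp add: vec_eq_iff mat_mult_component)

theorem theorem4p5:
  fixes M :: "complex^'n^'n"
  assumes "unitary_matrix M"
    and "conj_transpose M = M \<or> conj_transpose M = - M"
  shows "(\<forall>A \<in> jordan_algebra M.
      (\<forall>\<mu> \<in> \<real>. \<exists>\<Delta> \<in> jordan_algebra M.
          \<mu> \<in> spectrum (A + \<Delta>) \<and>
          eigenvalue_error (jordan_algebra M) \<mu> A = ereal (spectral_norm \<Delta>) \<and>
          ereal (spectral_norm \<Delta>) = eigenvalue_error UNIV \<mu> A) \<and>
      (\<forall>\<epsilon>>0. pseudospectrum (jordan_algebra M) \<epsilon> A \<inter> \<real> = pseudospectrum UNIV \<epsilon> A \<inter> \<real>))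
    \<and>
    (\<forall>A \<in> lie_algebra M.
      (\<forall>\<mu> \<in> imaginary_axis. \<exists>\<Delta> \<in> lie_algebra M.
          \<mu> \<in> spectrum (A + \<Delta>) \<and>
          eigenvalue_error (lie_algebra M) \<mu> A = ereal (spectral_norm \<Delta>) \<and>
          ereal (spectral_norm \<Delta>) = eigenvalue_error UNIV \<mu> A) \<and>
      (\<forall>\<epsilon>>0. pseudospectrum (lie_algebra M) \<epsilon> A \<inter> imaginary_axis
             = pseudospectrum UNIV \<epsilon> A \<inter> imaginary_axis))"
proof -
  obtain p :: complex where p: "p \<in> {1, -1}" "conj_transpose M = mat p ** M"
    using assms(2) mat_neg_one_mult[of M] by fastforce
  \<comment> \<open>Both algebras are put in the common form with \<open>q = 1\<close> and
    \<open>q = -1\<close>.\<close>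
  have J: "jordan_algebra M = {X. form_adjoint M X = mat 1 ** X}"
    by (simp add: jordan_algebra_def)
  have L: "lie_algebra M = {X. form_adjoint M X = mat (- 1) ** X}"
    by (simp only: lie_algebra_def mat_neg_one_mult)
  show ?thesis
    using form_structured_eq_unstructured[OF assms(1) p(2,1) _ J Reals_eq_cnj_fixed]
      form_structured_eq_unstructured[OF assms(1) p(2,1) _ L imaginary_axis_eq]
    by simp
qed

end
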